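(* Let $p$ be prime, let $G$ be an abelian $p$-group and let $H$ be a subgroup of $G$. Suppose that $L$ is an $(H,k,s)$ contracted difference matrix and that $(m_{ij}+H)$ is a $(G/H,k,t)$ contracted difference matrix, where each $m_{ij}\in G$, and let $M=(m_{ij})$. Then the matrix $[\,L\mid M\,]$ obtained by placing the columns of $L$ followed by the columns of $M$ is a $(G,k,s+t)$ contracted difference matrix.
   Context: All groups are finite, and abelian groups are written additively. Difference matrix: for a non-trivial group $G$, a $(G,m,\lambda)$ difference matrix is an $m\times\lambda|G|$ matrix $(a_{ij})$ with entries in $G$ such that, for all distinct rows $i$ and $\ell$, the multiset of differences $\{a_{ij}-a_{\ell j} : 0\le j\le \lambda|G|-1\}$ contains each element of $G$ exactly $\lambda$ times. $p$-expansion: let $p$ be prime and let $M$ be a $k\times\ell$ matrix over an abelian $p$-group $G$. The $p$-expansion $f_p(M)$ is the $p^k\times p^\ell$ matrix over $G$ whose rows are indexed by $\mathbf{r}\in\mathbb{Z}_p^k$ and whose columns are indexed by $\mathbf{c}\in\mathbb{Z}_p^\ell$, with $(\mathbf{r},\mathbf{c})$ entry $\mathbf{r}M\mathbf{c}^{\intercal}=\sum_{i,j} r_i c_j M_{ij}$, where $\mathbf r,\mathbf c$ are row vectors whose entries are taken as the integer representatives in $\{0,1,\dots,p-1\}$, and integers act on $G$ in the usual way. Contracted difference matrix: let $p$ be prime and let $G$ be an abelian group of order $p^n$. A $k\times(n+s)$ matrix $M$ over $G$ (with $k\ge1$, $s\ge0$ integers) is a $(G,k,s)$ contracted difference matrix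 if the $p^k\times p^{n+s}$ matrix $f_p(M)$ is a $(G,p^k,p^s)$ difference matrix. *)

theory Defs
  imports
    "HOL-Algebra.Coset"
    "HOL-Computational_Algebra.Primes"
    "HOL-Library.Multiset"
    "HOL-Library.FuncSet"
    "Jordan_Normal_Form.Matrix"
begin

text \<open>
  Groups are \<open>HOL-Algebra\<close> records, so the group that is written additively in the mathematical
  text appears multiplicatively here: \<open>a - b\<close> is \<open>a \<otimes> inv b\<close>, an integer multiple is a power, and
  a sum is a \<open>finprod\<close>.

  The rows and columns of a difference matrix are indexed by arbitrary finite sets \<open>R\<close> and \<open>C\<close>,
  since those of a \<open>p\<close>-expansion are indexed by vectors; only the sizes of \<open>R\<close> and \<open>C\<close> matter.
\<close>

definition difference_matrix ::
  "('a, 'b) monoid_scheme \<Rightarrow> nat \<Rightarrow> nat \<Rightarrow> 'r set \<Rightarrow> 'c set \<Rightarrow> ('r \<Rightarrow> 'c \<Rightarrow> 'a) \<Rightarrow> bool"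
where
  "difference_matrix G m lam R C A \<longleftrightarrow>
     group G \<and> finite (carrier G) \<and> carrier G \<noteq> {\<one>\<^bsub>G\<^esub>} \<and>
     finite R \<and> card R = m \<and> finite C \<and> card C = lam * Coset.order G \<and>
     (\<forall>i\<in>R. \<forall>j\<in>C. A i j \<in> carrier G) \<and>
     (\<forall>i\<in>R. \<forall>l\<in>R. i \<noteq> l \<longrightarrow>
        (\<forall>g\<in>carrier G. count {# A i j \<otimes>\<^bsub>G\<^esub> inv\<^bsub>G\<^esub> (A l j). j \<in># mset_set C #} g = lam))"

text \<open>
  \<open>\<int>\<^sub>p\<^sup>k\<close>, each vector being given by its integer representatives in \<open>{0, \<dots>, p - 1}\<close>.
\<close>

definition Zp_vectors :: "nat \<Rightarrow> nat \<Rightarrow> (nat \<Rightarrow> nat) set" where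
  "Zp_vectors p k = {..<k} \<rightarrow>\<^sub>E {..<p}"

text \<open>
  The \<open>(r, c)\<close> entry of the \<open>p\<close>-expansion of \<open>M\<close>. The prime only enters through the index sets
  \<open>Zp_vectors p (dim_row M)\<close> and \<open>Zp_vectors p (dim_col M)\<close> over which \<open>r\<close> and \<open>c\<close> range.
\<close>

definition expansion ::
  "('a, 'b) monoid_scheme \<Rightarrow> 'a mat \<Rightarrow> (nat \<Rightarrow> nat) \<Rightarrow> (nat \<Rightarrow> nat) \<Rightarrow> 'a"
where
  "expansion G M r c =
     (\<Otimes>\<^bsub>G\<^esub>i \<in> {..<dim_row M}. \<Otimes>\<^bsub>G\<^esub>j \<in> {..<dim_col M}. M $$ (i, j) [^]\<^bsub>G\<^esub> (r i * c j))"

definition contracted_difference_matrix ::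
  "nat \<Rightarrow> ('a, 'b) monoid_scheme \<Rightarrow> nat \<Rightarrow> nat \<Rightarrow> 'a mat \<Rightarrow> bool"
where
  "contracted_difference_matrix p G k s M \<longleftrightarrow>
     prime p \<and> comm_group G \<and> k \<ge> 1 \<and>
     (\<exists>n. Coset.order G = p ^ n \<and> M \<in> carrier_mat k (n + s)) \<and>
     elements_mat M \<subseteq> carrier G \<and>
     difference_matrix G (p ^ k) (p ^ s)
       (Zp_vectors p (dim_row M)) (Zp_vectors p (dim_col M)) (expansion G M)"

text \<open>
  The matrix \<open>[A | B]\<close>; the intended use is \<open>dim_row A = dim_row B\<close>.
\<close>

definition append_columns :: "'a mat \<Rightarrow> 'a mat \<Rightarrow> 'a mat" where
  "append_columns A B =
     mat (dim_row A) (dim_col A + dim_col B)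
       (\<lambda>(i, j). if j < dim_col A then A $$ (i, j) else B $$ (i, j - dim_col A))"

end

theory Submission
  imports Defs
begin

text \<open>
  Let \<open>E\<close> be the expansion of \<open>[L | M]\<close>. A column index \<open>e\<close> of \<open>E\<close> amounts to a pair \<open>(c, d)\<close> of
  column indices of the expansions of \<open>L\<close> and \<open>M\<close>, and the difference of two fixed rows of \<open>E\<close> at
  \<open>e\<close> is \<open>u c \<otimes> v d\<close>, where \<open>u\<close> and \<open>v\<close> are the differences of the corresponding rows for \<open>L\<close> and
  \<open>M\<close> (\<open>expansion_append_columns\<close>). All values of \<open>u\<close> lie in \<open>H\<close>. Given \<open>g\<close>, the equation
  \<open>u c \<otimes> v d = g\<close> can therefore hold only if \<open>v d\<close> lies in the coset of \<open>g\<close>, and once it does, it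
  prescribes \<open>u c\<close> as a certain element of \<open>H\<close>. Taking an expansion commutes with group
  homomorphisms (\<open>expansion_hom\<close>); applied to the projection \<open>G \<rightarrow> G/H\<close>, this says that the cosets
  of the \<open>v d\<close> are the row differences for the given matrix over \<open>G/H\<close>, so \<open>p\<^sup>t\<close> of the \<open>d\<close>
  qualify. Applied to the inclusion \<open>H \<rightarrow> G\<close>, it says that the \<open>u c\<close> are the row differences for
  \<open>L\<close> as a matrix over \<open>H\<close>, so each such \<open>d\<close> comes with \<open>p\<^sup>s\<close> choices of \<open>c\<close>. This gives
  \<open>p ^ (s + t)\<close> solutions (\<open>card_product_fibre\<close>). By Lagrange, \<open>[L | M]\<close> has the right
  number of columns: the exponents of \<open>|H|\<close> and \<open>|G/H|\<close> add up to that of \<open>|G|\<close>.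
\<close>

section \<open>Index vectors\<close>

lemma finite_Zp_vectors: "finite (Zp_vectors p k)"
  by (simp add: Zp_vectors_def finite_PiE)

lemma card_Zp_vectors: "card (Zp_vectors p k) = p ^ k"
  by (simp add: Zp_vectors_def card_PiE)

lemma bij_betw_split_Zp_vectors:
  "bij_betw (\<lambda>e. (restrict e {..<a}, \<lambda>j\<in>{..<b}. e (a + j)))
     (Zp_vectors p (a + b)) (Zp_vectors p a \<times> Zp_vectors p b)"
  by (rule bij_betw_byWitness[where
        f' = "\<lambda>(c, d). \<lambda>j\<in>{..<a + b}. if j < a then c j else d (j - a)"])
    (auto simp: Zp_vectors_def PiE_def Pi_def extensional_def restrict_def fun_eq_iff)

section \<open>Expansions\<close>

lemma (in comm_monoid) expansion_entry_closed:
  assumes "elements_mat M \<subseteq> carrier G" "i < dim_row M" "j < dim_col M"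
  shows "M $$ (i, j) [^] (n :: nat) \<in> carrier G"
  using assms by (intro nat_pow_closed) (auto intro: elements_matI)

lemma (in comm_monoid) expansion_closed:
  assumes "elements_mat M \<subseteq> carrier G"
  shows "expansion G M r c \<in> carrier G"
  unfolding expansion_def using expansion_entry_closed[OF assms]
  by (intro finprod_closed Pi_I) auto

lemma (in comm_monoid) expansion_cong:
  assumes "elements_mat M \<subseteq> carrier G"
    and "\<And>j. j < dim_col M \<Longrightarrow> c j = c' j"
  shows "expansion G M r c = expansion G M r c'"
  unfolding expansion_def using assms(2) expansion_entry_closed[OF assms(1)]
  by (intro finprod_cong' Pi_I finprod_closed) auto

lemma (in group_hom) hom_finprod:
  assumes "comm_group G" "comm_group H" "f \<in> A \<rightarrow> carrier G"
  shows "h (finprod G f A) = finprod H (\<lambda>i. h (f i)) A"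
proof -
  interpret G: comm_group G by fact
  interpret H: comm_group H by fact
  show ?thesis
    using assms(3) by (induct A rule: infinite_finite_induct) (auto simp: Pi_def)
qed

text \<open>
  This serves both for the projection onto a quotient and, as the map \<open>id\<close>, for the inclusion of a
  subgroup, where it says that products and powers may be formed in either group.
\<close>

lemma (in group_hom) expansion_hom:
  assumes "comm_group G" "comm_group H" "elements_mat M \<subseteq> carrier G"
  shows "h (expansion G M r c) = expansion H (map_mat h M) r c"
proof -
  interpret G: comm_group G by fact
  interpret H: comm_group H by fact
  have entry: "M $$ (i, j) \<in> carrier G" if "i < dim_row M" "j < dim_col M" for i j
    using that assms(3) by (auto intro: elements_matI)
  note pow = G.expansion_entry_closed[OF assms(3)]
  have row: "h (\<Otimes>j\<in>{..<dim_col M}. M $$ (i, j) [^] (r i * c j)) =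
      (\<Otimes>\<^bsub>H\<^esub>j\<in>{..<dim_col M}. map_mat h M $$ (i, j) [^]\<^bsub>H\<^esub> (r i * c j))"
    if "i < dim_row M" for i
  proof -
    have "h (\<Otimes>j\<in>{..<dim_col M}. M $$ (i, j) [^] (r i * c j)) =
        (\<Otimes>\<^bsub>H\<^esub>j\<in>{..<dim_col M}. h (M $$ (i, j) [^] (r i * c j)))"
      using that pow by (intro hom_finprod assms) auto
    also have "\<dots> = (\<Otimes>\<^bsub>H\<^esub>j\<in>{..<dim_col M}. map_mat h M $$ (i, j) [^]\<^bsub>H\<^esub> (r i * c j))"
      using that entry by (intro H.finprod_cong' Pi_I H.nat_pow_closed) (auto simp: hom_nat_pow)
    finally show ?thesis .
  qed
  have "h (expansion G M r c) = (\<Otimes>\<^bsub>H\<^esub>i\<in>{..<dim_row M}.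
      h (\<Otimes>j\<in>{..<dim_col M}. M $$ (i, j) [^] (r i * c j)))"
    unfolding expansion_def using pow
    by (intro hom_finprod assms(1,2) Pi_I G.finprod_closed) auto
  also have "\<dots> = expansion H (map_mat h M) r c"
    unfolding expansion_def index_map_mat(2,3) using row entry
    by (intro H.finprod_cong' Pi_I H.finprod_closed H.nat_pow_closed) auto
  finally show ?thesis .
qed

lemma elements_mat_append_columns:
  assumes "dim_row A = dim_row B" "elements_mat A \<subseteq> S" "elements_mat B \<subseteq> S"
  shows "elements_mat (append_columns A B) \<subseteq> S"
proof
  fix x assume "x \<in> elements_mat (append_columns A B)"
  then obtain i j where *: "i < dim_row A" "j < dim_col A + dim_col B"
    "x = (if j < dim_col A then A $$ (i, j) else B $$ (i, j - dim_col A))"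
    by (fastforce simp: append_columns_def)
  then have "x \<in> elements_mat A" if "j < dim_col A"
    using that by (auto intro: elements_matI)
  moreover from * have "x \<in> elements_mat B" if "\<not> j < dim_col A"
    using that assms(1) by (auto intro: elements_matI[of B "dim_row B" "dim_col B" i "j - dim_col A"])
  ultimately show "x \<in> S" using assms(2,3) by blast
qed

lemma (in comm_monoid) expansion_append_columns:
  assumes "dim_row A = dim_row B"
    and "elements_mat A \<subseteq> carrier G" "elements_mat B \<subseteq> carrier G"
  shows "expansion G (append_columns A B) r e =
    expansion G A r e \<otimes> expansion G B r (\<lambda>j. e (dim_col A + j))"
proof -
  define a b where "a = dim_col A" and "b = dim_col B"
  note closed = expansion_entry_closed[OF assms(2)] expansion_entry_closed[OF assms(3)]
  let ?f = "\<lambda>i j. append_columns A B $$ (i, j) [^] (r i * e j)"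
  have row: "(\<Otimes>j\<in>{..<a + b}. ?f i j) =
      (\<Otimes>j\<in>{..<a}. A $$ (i, j) [^] (r i * e j)) \<otimes>
      (\<Otimes>j\<in>{..<b}. B $$ (i, j) [^] (r i * e (a + j)))"
    if i: "i < dim_row A" for i
  proof -
    have split: "{..<a + b} = {..<a} \<union> (+) a ` {..<b}"
      by (simp add: lessThan_atLeast0 ivl_disj_un add.commute)
    have left: "?f i j = A $$ (i, j) [^] (r i * e j)" if "j < a" for j
      using that i by (simp add: append_columns_def a_def)
    have right: "?f i (a + j) = B $$ (i, j) [^] (r i * e (a + j))" if "j < b" for j
      using that i by (simp add: append_columns_def a_def b_def)
    have lc: "?f i \<in> {..<a} \<rightarrow> carrier G"
      using left closed(1) i by (auto simp: a_def)
    have rc: "?f i \<in> (+) a ` {..<b} \<rightarrow> carrier G"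
      using right closed(2) i assms(1) by (auto simp: b_def)
    have "(\<Otimes>j\<in>{..<a + b}. ?f i j) = finprod G (?f i) {..<a} \<otimes> finprod G (?f i) ((+) a ` {..<b})"
      unfolding split by (rule finprod_Un_disjoint) (use lc rc in auto)
    also have "finprod G (?f i) ((+) a ` {..<b}) = (\<Otimes>j\<in>{..<b}. ?f i (a + j))"
      using rc by (rule finprod_reindex) simp
    also have "\<dots> = (\<Otimes>j\<in>{..<b}. B $$ (i, j) [^] (r i * e (a + j)))"
      using right closed(2) i assms(1) by (intro finprod_cong') (auto simp: b_def)
    also have "finprod G (?f i) {..<a} = (\<Otimes>j\<in>{..<a}. A $$ (i, j) [^] (r i * e j))"
      using left closed(1) i by (intro finprod_cong') (auto simp: a_def)
    finally show ?thesis .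
  qed
  have "expansion G (append_columns A B) r e = (\<Otimes>i\<in>{..<dim_row A}. \<Otimes>j\<in>{..<a + b}. ?f i j)"
    by (simp add: expansion_def append_columns_def a_def b_def)
  also have "\<dots> = (\<Otimes>i\<in>{..<dim_row A}. (\<Otimes>j\<in>{..<a}. A $$ (i, j) [^] (r i * e j)) \<otimes>
      (\<Otimes>j\<in>{..<b}. B $$ (i, j) [^] (r i * e (a + j))))"
    using closed assms(1) row
    by (intro finprod_cong' Pi_I m_closed finprod_closed) (auto simp: a_def b_def)
  also have "\<dots> = expansion G A r e \<otimes> expansion G B r (\<lambda>j. e (a + j))"
    unfolding expansion_def a_def[symmetric] b_def[symmetric] assms(1)[symmetric]
    using closed assms(1)
    by (intro finprod_multf Pi_I finprod_closed) (auto simp: a_def b_def)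
  finally show ?thesis by (simp add: a_def)
qed

section \<open>Counting differences\<close>

lemma count_image_mset_set:
  assumes "finite C"
  shows "count {# f j. j \<in># mset_set C #} g = card {j \<in> C. f j = g}"
  using assms by (simp add: count_image_mset' eq_commute)

text \<open>
  The product equals \<open>g\<close> exactly if \<open>u c = g \<otimes> inv (v d)\<close>. As \<open>u\<close> takes values in \<open>H\<close>, this has no
  solution \<open>c\<close> unless \<open>v d\<close> is in the coset \<open>H #> g\<close>, and otherwise it has \<open>l\<close> of them.
\<close>

lemma (in group) card_product_fibre:
  assumes "subgroup H G" "finite C" "finite D" "g \<in> carrier G"
    and u: "u \<in> C \<rightarrow> H" and v: "v \<in> D \<rightarrow> carrier G"
    and fibre_u: "\<And>x. x \<in> H \<Longrightarrow> card {c \<in> C. u c = x} = l"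
    and fibre_v: "card {d \<in> D. H #> v d = H #> g} = m"
  shows "card {(c, d) \<in> C \<times> D. u c \<otimes> v d = g} = l * m"
proof -
  interpret H: subgroup H G by fact
  let ?D = "{d \<in> D. H #> v d = H #> g}"
  have eq: "u c \<otimes> v d = g \<longleftrightarrow> u c = g \<otimes> inv (v d)" if "c \<in> C" "d \<in> D" for c d
  proof -
    have "u c \<in> carrier G" "v d \<in> carrier G" using u v that by (auto intro: H.mem_carrier)
    then show ?thesis using \<open>g \<in> carrier G\<close> by (metis inv_solve_right)
  qed
  have coset: "g \<otimes> inv (v d) \<in> H \<longleftrightarrow> H #> v d = H #> g" if "d \<in> D" for d
  proof -
    have "v d \<in> carrier G" using v that by auto
    then have "g \<otimes> inv (v d) \<in> H \<longleftrightarrow> g \<in> H #> v d"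
      using H.rcos_module[OF is_group] \<open>g \<in> carrier G\<close> by simp
    also have "\<dots> \<longleftrightarrow> H #> v d = H #> g"
      using \<open>v d \<in> carrier G\<close> \<open>g \<in> carrier G\<close> assms(1)
      by (metis repr_independence repr_independenceD)
    finally show ?thesis .
  qed
  have "{(c, d) \<in> C \<times> D. u c \<otimes> v d = g} =
      prod.swap ` (SIGMA d:?D. {c \<in> C. u c = g \<otimes> inv (v d)})"
    using eq coset u by (auto simp: image_iff Bex_def) (metis PiE)+
  then have "card {(c, d) \<in> C \<times> D. u c \<otimes> v d = g} =
      card (SIGMA d:?D. {c \<in> C. u c = g \<otimes> inv (v d)})"
    by (simp add: card_image)
  also have "\<dots> = (\<Sum>d\<in>?D. card {c \<in> C. u c = g \<otimes> inv (v d)})"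
    using \<open>finite C\<close> \<open>finite D\<close> by simp
  also have "\<dots> = (\<Sum>d\<in>?D. l)"
    using fibre_u coset by (intro sum.cong) auto
  also have "\<dots> = l * m" using fibre_v by simp
  finally show ?thesis .
qed

lemma contracted_difference_matrixD:
  assumes "contracted_difference_matrix p G k s M"
  shows "comm_group G" "k \<ge> 1" "finite (carrier G)" "carrier G \<noteq> {\<one>\<^bsub>G\<^esub>}"
    "elements_mat M \<subseteq> carrier G"
    and "\<exists>a. Coset.order G = p ^ a \<and> M \<in> carrier_mat k (a + s)"
  using assms unfolding contracted_difference_matrix_def difference_matrix_def by blast+

lemma card_contracted_difference_matrix:
  assumes "contracted_difference_matrix p G k s M"
    and "r \<in> Zp_vectors p (dim_row M)" "r' \<in> Zp_vectors p (dim_row M)" "r \<noteq> r'"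
    and "g \<in> carrier G"
  shows "card {c \<in> Zp_vectors p (dim_col M).
    expansion G M r c \<otimes>\<^bsub>G\<^esub> inv\<^bsub>G\<^esub> (expansion G M r' c) = g} = p ^ s"
  using assms
  unfolding contracted_difference_matrix_def difference_matrix_def
    count_image_mset_set[OF finite_Zp_vectors]
  by blast

text \<open>
  The sizes of the index sets and the membership of the entries in \<open>G\<close> are automatic for an
  expansion, so of the conditions on a difference matrix only those on the group and the count of
  differences are left.
\<close>

lemma contracted_difference_matrixI:
  assumes "prime p" "comm_group G" "k \<ge> 1" "Coset.order G = p ^ a" "finite (carrier G)"
    and "carrier G \<noteq> {\<one>\<^bsub>G\<^esub>}" "M \<in> carrier_mat k (a + s)" "elements_mat M \<subseteq> carrier G"
    and "\<And>r r' g. \<lbrakk>r \<in> Zp_vectors p k; r' \<in> Zp_vectors p k; r \<noteq> r'; g \<in> carrier G\<rbrakk> \<Longrightarrow>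
       card {c \<in> Zp_vectors p (a + s).
         expansion G M r c \<otimes>\<^bsub>G\<^esub> inv\<^bsub>G\<^esub> (expansion G M r' c) = g} = p ^ s"
  shows "contracted_difference_matrix p G k s M"
proof -
  interpret comm_group G by fact
  show ?thesis
    using assms
    unfolding contracted_difference_matrix_def difference_matrix_def
    by (auto simp: count_image_mset_set[OF finite_Zp_vectors] finite_Zp_vectors card_Zp_vectors
        power_add expansion_closed)
qed

section \<open>Concatenation\<close>

theorem theorem5p11:
  fixes G :: "('a, 'b) monoid_scheme"
    and H :: "'a set"
    and p n k s t :: nat
    and L M :: "'a mat"
  assumes "prime p"
    and "comm_group G" and "Coset.order G = p ^ n"
    and "subgroup H G"
    and "contracted_difference_matrix p (G\<lparr>carrier := H\<rparr>) k s L"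
    and "elements_mat M \<subseteq> carrier G"
    and "contracted_difference_matrix p (G Mod H) k t (map_mat (\<lambda>m. H #>\<^bsub>G\<^esub> m) M)"
  shows "contracted_difference_matrix p G k (s + t) (append_columns L M)"
proof -
  interpret comm_group G by fact
  interpret H: subgroup H G by fact
  interpret normal H G using \<open>subgroup H G\<close> by (rule subgroup_imp_normal)
  let ?H = "G\<lparr>carrier := H\<rparr>" and ?Q = "G Mod H" and ?\<pi> = "\<lambda>m. H #>\<^bsub>G\<^esub> m"
  note L = contracted_difference_matrixD[OF assms(5)]
  note M = contracted_difference_matrixD[OF assms(7)]
  obtain a where ord_H: "Coset.order ?H = p ^ a" and L_dim: "L \<in> carrier_mat k (a + s)"
    using L(6) by blast
  obtain b where ord_Q: "Coset.order ?Q = p ^ b" and M_dim: "map_mat ?\<pi> M \<in> carrier_mat k (b + t)"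
    using M(6) by blast
  interpret incl: group_hom ?H G id
    using L(1) H.subset
    by (auto simp: group_hom_def group_hom_axioms_def hom_def comm_group_def)
  interpret proj: group_hom G ?Q ?\<pi>
    using factorgroup_is_group r_coset_hom_Mod
    by (simp add: group_hom_def group_hom_axioms_def)
  have dims: "dim_row L = k" "dim_row M = k" "dim_col L = a + s" "dim_col M = b + t"
    using L_dim M_dim by auto
  have entries_L: "elements_mat L \<subseteq> carrier G" using L(5) H.subset by auto
  have exp_L: "expansion ?H L r c = expansion G L r c" for r c
  proof -
    have "map_mat id L = L" by (rule eq_matI) auto
    then show ?thesis using incl.expansion_hom[OF L(1) assms(2) L(5)] by simp
  qed
  have exp_L_in: "expansion G L r c \<in> H" for r c
    using comm_monoid.expansion_closed[OF comm_group.axioms(1)[OF L(1)] L(5)] exp_L by simp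
  note exp_M_in = expansion_closed[OF assms(6)]
  define u where "u r r' c = expansion G L r c \<otimes>\<^bsub>G\<^esub> inv\<^bsub>G\<^esub> (expansion G L r' c)" for r r' c
  define v where "v r r' d = expansion G M r d \<otimes>\<^bsub>G\<^esub> inv\<^bsub>G\<^esub> (expansion G M r' d)" for r r' d
  have u_in: "u r r' c \<in> H" for r r' c
    using exp_L_in by (simp add: u_def H.m_closed H.m_inv_closed)
  have v_in: "v r r' d \<in> carrier G" for r r' d
    using exp_M_in by (simp add: v_def)
  have fibre_u: "card {c \<in> Zp_vectors p (a + s). u r r' c = x} = p ^ s"
    if "r \<in> Zp_vectors p k" "r' \<in> Zp_vectors p k" "r \<noteq> r'" "x \<in> H" for r r' x
    using card_contracted_difference_matrix[OF assms(5), of r r' x] that exp_L_in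
    by (simp add: dims exp_L u_def m_inv_consistent[OF \<open>subgroup H G\<close>])
  have proj_v: "?\<pi> (v r r' d) =
      expansion ?Q (map_mat ?\<pi> M) r d \<otimes>\<^bsub>?Q\<^esub> inv\<^bsub>?Q\<^esub> (expansion ?Q (map_mat ?\<pi> M) r' d)"
    for r r' d
    using exp_M_in
    by (simp only: v_def proj.hom_mult proj.hom_inv inv_closed
        proj.expansion_hom[OF assms(2) M(1) assms(6)])
  have fibre_v: "card {d \<in> Zp_vectors p (b + t). ?\<pi> (v r r' d) = ?\<pi> g} = p ^ t"
    if "r \<in> Zp_vectors p k" "r' \<in> Zp_vectors p k" "r \<noteq> r'" "g \<in> carrier G" for r r' g
    using card_contracted_difference_matrix[OF assms(7), of r r' "?\<pi> g"] that
      proj.hom_closed[OF that(4)]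
    by (simp add: dims proj_v)
  have order: "Coset.order G = p ^ (a + b)"
    using lagrange[OF \<open>subgroup H G\<close>] ord_H ord_Q
    by (simp add: Coset.order_def FactGroup_def power_add mult.commute)
  have fin: "finite (carrier G)"
    using order \<open>prime p\<close> by (simp add: order_gt_0_iff_finite[symmetric] prime_gt_0_nat)
  show ?thesis
  proof (rule contracted_difference_matrixI[OF assms(1,2) L(2) order fin])
    show "carrier G \<noteq> {\<one>\<^bsub>G\<^esub>}" using L(4) H.subset H.one_closed by auto
    show "append_columns L M \<in> carrier_mat k (a + b + (s + t))"
      using dims by (auto simp: append_columns_def)
    show "elements_mat (append_columns L M) \<subseteq> carrier G"
      using dims entries_L assms(6) by (intro elements_mat_append_columns) auto
    fix r r' g
    assume r: "r \<in> Zp_vectors p k" "r' \<in> Zp_vectors p k" "r \<noteq> r'" and g: "g \<in> carrier G"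
    let ?C = "Zp_vectors p (a + s)" and ?D = "Zp_vectors p (b + t)"
    let ?E = "expansion G (append_columns L M)"
    let ?split = "\<lambda>e. (restrict e {..<a + s}, \<lambda>j\<in>{..<b + t}. e (a + s + j))"
    have diff: "?E r e \<otimes>\<^bsub>G\<^esub> inv\<^bsub>G\<^esub> (?E r' e) =
        u r r' (fst (?split e)) \<otimes>\<^bsub>G\<^esub> v r r' (snd (?split e))" for e
    proof -
      have E: "?E r e = expansion G L r (fst (?split e)) \<otimes>\<^bsub>G\<^esub> expansion G M r (snd (?split e))" for r
        using dims
        by (simp add: expansion_append_columns[OF _ entries_L assms(6)]
            expansion_cong[OF entries_L, of "restrict e {..<a + s}" e]
            expansion_cong[OF assms(6), of "\<lambda>j\<in>{..<b + t}. e (a + s + j)" "\<lambda>j. e (a + s + j)"])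
      have L_in: "expansion G L r c \<in> carrier G" for r c
        using exp_L_in by (rule H.mem_carrier)
      show ?thesis
        unfolding E u_def v_def using L_in exp_M_in by (simp add: inv_mult m_ac)
    qed
    have bij: "bij_betw ?split (Zp_vectors p ((a + s) + (b + t))) (?C \<times> ?D)"
      by (rule bij_betw_split_Zp_vectors)
    have "bij_betw ?split
        {e \<in> Zp_vectors p ((a + s) + (b + t)). ?E r e \<otimes>\<^bsub>G\<^esub> inv\<^bsub>G\<^esub> (?E r' e) = g}
        {w \<in> ?C \<times> ?D. u r r' (fst w) \<otimes>\<^bsub>G\<^esub> v r r' (snd w) = g}"
      by (rule bij_betw_Collect[OF bij]) (simp only: diff)
    also have "{w \<in> ?C \<times> ?D. u r r' (fst w) \<otimes>\<^bsub>G\<^esub> v r r' (snd w) = g} =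
        {(c, d) \<in> ?C \<times> ?D. u r r' c \<otimes>\<^bsub>G\<^esub> v r r' d = g}"
      by auto
    finally have "bij_betw ?split
        {e \<in> Zp_vectors p ((a + s) + (b + t)). ?E r e \<otimes>\<^bsub>G\<^esub> inv\<^bsub>G\<^esub> (?E r' e) = g}
        {(c, d) \<in> ?C \<times> ?D. u r r' c \<otimes>\<^bsub>G\<^esub> v r r' d = g}" .
    then have "card {e \<in> Zp_vectors p ((a + s) + (b + t)). ?E r e \<otimes>\<^bsub>G\<^esub> inv\<^bsub>G\<^esub> (?E r' e) = g} =
        card {(c, d) \<in> ?C \<times> ?D. u r r' c \<otimes>\<^bsub>G\<^esub> v r r' d = g}"
      by (rule bij_betw_same_card)
    also have "\<dots> = p ^ s * p ^ t"
      by (rule card_product_fibre[OF \<open>subgroup H G\<close> finite_Zp_vectors finite_Zp_vectors g])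
        (use u_in v_in fibre_u[OF r] fibre_v[OF r g] in auto)
    finally show "card {e \<in> Zp_vectors p (a + b + (s + t)). ?E r e \<otimes>\<^bsub>G\<^esub> inv\<^bsub>G\<^esub> (?E r' e) = g} =
        p ^ (s + t)"
      by (simp add: power_add ac_simps)
  qed
qed

end
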